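(* Let $h$ be a non-negative similarity invariant function on $\mathrm{Sym}_2^+$, let $(\alpha^{(l)})_{l\ge 1}$ be a sequence in $P_m^+$ and let $\alpha^{(0)}\in P_m^+$ with $\alpha^{(l)}\to\alpha^{(0)}$. Suppose that $h$ is such that the function $f\mapsto H(f;\alpha^{(0)})$ is convex in $P_k^+$. For every $l\ge 0$ let $\hat f^{(l)}=\operatorname{argmin}_{f\in P_k^+} H(f;\alpha^{(l)})$. Then $\hat f^{(l)}\to \hat f^{(0)}$ as $l\to\infty$.
   Context: $\mathrm{Sym}_2^+$ is the set of real symmetric positive definite $2\times 2$ matrices. A similarity invariant function on $\mathrm{Sym}_2^+$ is a continuous function $h:\mathrm{Sym}_2^+\times \mathrm{Sym}_2^+\to\mathbb{R}$ with $h(AXA',AYA')=h(X,Y)$ for all $X,Y\in \mathrm{Sym}_2^+$ and $A\in GL_2(\mathbb{R})$ ($'$ denotes transpose); it is non-negative if $h(X,Y)\ge 0$ for all $X,Y$. For a positive integer $N$, $P_N^+=\{x\in\mathbb{R}^N: x_i\ge 0,\ \sum_i x_i=1\}$ is the compact simplex, with the Euclidean ($L_2$) topology. Elements of $P_k^+$ are called probability mass functions. Fix points $p_1,\dots,p_k$ (distribution domain) and $q_1,\dots,q_k$ (observation points) on the unit sphere $\mathbb{S}^2\subset\mathbb{R}^3$, with $p_i\ne -q_j$ for all $i,j$. Let $\overrightarrow{q_jp_i}=\frac{\cos^{-1}\langle p_i,q_j\rangle}{(1-\langle p_i,q_j\rangle^2)^{1/2}}\,(p_i-\langle p_i,q_j\rangle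 q_j)$ (and $0$ if $p_i=q_j$), a vector of the tangent plane to $\mathbb{S}^2$ at $q_j$; fix a basis of each such tangent plane and regard $\overrightarrow{q_jp_i}$ as a column vector in $\mathbb{R}^2$ when forming matrix products. The norm $\|\overrightarrow{q_jp_i}\|$ is the Riemannian norm, i.e. the Euclidean norm in $\mathbb{R}^3$. Fix $r$ to be either $r\equiv 1$ or $r(t)=(1-\frac{\pi}{2t})^2$; in the latter case also $p_i\neq q_j$ for all $i,j$. For $f=(f_1,\dots,f_k)\in P_k^+$ put $$\Sigma[f]_j=\sum_{i=1}^k \overrightarrow{q_jp_i}\,(\overrightarrow{q_jp_i})'\, r(\|\overrightarrow{q_jp_i}\|)\, f_i,\qquad j=1,\dots,k.$$ The matrices $\Sigma[f]_j$, $f\in P_k^+$, are taken to be elements of $\mathrm{Sym}_2^+$, so that $h$ can be applied to them. Fix probability mass functions $f^1,\dots,f^m\in P_k^+$, put $C_j^s=\Sigma[f^s]_j$, and for $f\in P_k^+$, $\alpha=(\alpha_1,\dots,\alpha_m)\in P_m^+$ define $$H(f;\alpha)=\sum_{s=1}^m\alpha_s\sum_{j=1}^k h(\Sigma[f]_j,C_j^s).$$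
   Formalization: Convexity and argmin are over the f in P_k^+ with all Σ[f]_j in Sym_2^+ (where H is defined; point masses give rank ≤ 1), with all f^s in this set; the minimizer at l=0 is assumed unique (h=0 is a counterexample otherwise), those for l≥1 need not be. *)

theory Defs
  imports "HOL-Analysis.Analysis"
begin

definition Sym_pos :: "(real^2^2) set" where
  "Sym_pos = {A. transpose A = A \<and> (\<forall>x. x \<noteq> 0 \<longrightarrow> 0 < x \<bullet> (A *v x))}"

definition similarity_invariant :: "(real^2^2 \<Rightarrow> real^2^2 \<Rightarrow> real) \<Rightarrow> bool" where
  "similarity_invariant h \<longleftrightarrow>
     continuous_on (Sym_pos \<times> Sym_pos) (\<lambda>(X, Y). h X Y) \<and>
     (\<forall>X\<in>Sym_pos. \<forall>Y\<in>Sym_pos. \<forall>A. invertible A \<longrightarrow>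
        h (A ** X ** transpose A) (A ** Y ** transpose A) = h X Y)"

definition nonneg_on_Sym_pos :: "(real^2^2 \<Rightarrow> real^2^2 \<Rightarrow> real) \<Rightarrow> bool" where
  "nonneg_on_Sym_pos h \<longleftrightarrow> (\<forall>X\<in>Sym_pos. \<forall>Y\<in>Sym_pos. 0 \<le> h X Y)"

definition prob_simplex :: "(real^'n) set" where
  "prob_simplex = {x. (\<forall>i. 0 \<le> x $ i) \<and> (\<Sum>i\<in>UNIV. x $ i) = 1}"

definition tangent_plane :: "real^3 \<Rightarrow> (real^3) set" where
  "tangent_plane y = {v. v \<bullet> y = 0}"

definition tangent_basis :: "real^3 \<Rightarrow> (2 \<Rightarrow> real^3) \<Rightarrow> bool" where
  "tangent_basis y b \<longleftrightarrow>
     inj b \<and> independent (range b) \<and> span (range b) = tangent_plane y"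

definition tangent_coords :: "(2 \<Rightarrow> real^3) \<Rightarrow> real^3 \<Rightarrow> real^2" where
  "tangent_coords b v = (\<chi> a. representation (range b) v (b a))"

definition sphere_log :: "real^3 \<Rightarrow> real^3 \<Rightarrow> real^3" where
  "sphere_log y x =
     (if x = y then 0
      else (arccos (x \<bullet> y) / sqrt (1 - (x \<bullet> y)\<^sup>2)) *\<^sub>R (x - (x \<bullet> y) *\<^sub>R y))"

definition outer_square :: "real^2 \<Rightarrow> real^2^2" where
  "outer_square v = (columnvector v :: real^1^2) ** transpose (columnvector v)"

definition Sigma_field ::
  "('k::finite \<Rightarrow> real^3) \<Rightarrow> ('k \<Rightarrow> real^3) \<Rightarrow> ('k \<Rightarrow> 2 \<Rightarrow> real^3) \<Rightarrow> (real \<Rightarrow> real) \<Rightarrow>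
     real^'k \<Rightarrow> 'k \<Rightarrow> real^2^2" where
  "Sigma_field p q b r f j =
     (\<Sum>i\<in>UNIV. (r (norm (sphere_log (q j) (p i))) * f $ i) *\<^sub>R
        outer_square (tangent_coords (b j) (sphere_log (q j) (p i))))"

(* The mass functions f for which every Sigma[f]_j is positive definite, i.e. those at which H
   is defined. It is the whole simplex if all these matrices are positive definite
   (regular_pmfs_eq), but a point mass gives matrices of rank at most one
   (point_mass_not_regular), so assuming positive definiteness on the whole simplex would be
   contradictory. *)
definition regular_pmfs ::
  "('k::finite \<Rightarrow> real^3) \<Rightarrow> ('k \<Rightarrow> real^3) \<Rightarrow> ('k \<Rightarrow> 2 \<Rightarrow> real^3) \<Rightarrow> (real \<Rightarrow> real) \<Rightarrow>
     (real^'k) set" where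
  "regular_pmfs p q b r = {f \<in> prob_simplex. \<forall>j. Sigma_field p q b r f j \<in> Sym_pos}"

lemma regular_pmfs_eq:
  assumes "\<And>f j. f \<in> prob_simplex \<Longrightarrow> Sigma_field p q b r f j \<in> Sym_pos"
  shows "regular_pmfs p q b r = prob_simplex"
  using assms by (auto simp: regular_pmfs_def)

lemma point_mass_not_regular:
  "axis i 1 \<in> prob_simplex" "axis i 1 \<notin> regular_pmfs p q b r"
proof -
  show "axis i 1 \<in> prob_simplex"
    by (auto simp: prob_simplex_def axis_def)
  have no: "c *\<^sub>R outer_square v \<notin> Sym_pos" for c v
  proof -
    obtain x :: "real^2" where x: "x \<noteq> 0" "v $ 1 * x $ 1 + v $ 2 * x $ 2 = 0"
    proof (cases "v = 0")
      case True
      then show ?thesis using that[of "axis 1 1"] by (simp add: axis_eq_0_iff)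
    next
      case False
      then show ?thesis using that[of "vector [v $ 2, - v $ 1]"]
        by (auto simp: vec_eq_iff forall_2)
    qed
    have "(c *\<^sub>R outer_square v) *v x = 0"
    proof -
      have "((c *\<^sub>R outer_square v) *v x) $ a = c * v $ a * (v $ 1 * x $ 1 + v $ 2 * x $ 2)" for a
        by (simp add: outer_square_def columnvector_def transpose_def matrix_matrix_mult_def
            matrix_vector_mult_def sum_2 algebra_simps)
      then show ?thesis using x by (simp add: vec_eq_iff)
    qed
    then show ?thesis using x(1) by (force simp: Sym_pos_def)
  qed
  have "Sigma_field p q b r (axis i 1) j =
      r (norm (sphere_log (q j) (p i))) *\<^sub>R
        outer_square (tangent_coords (b j) (sphere_log (q j) (p i)))" for j
    unfolding Sigma_field_def
    by (subst sum.remove[of _ i]) (auto simp: axis_def intro!: sum.neutral)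
  then show "axis i 1 \<notin> regular_pmfs p q b r"
    using no by (simp add: regular_pmfs_def)
qed

definition H_fun ::
  "(real^2^2 \<Rightarrow> real^2^2 \<Rightarrow> real) \<Rightarrow> ('k::finite \<Rightarrow> real^3) \<Rightarrow> ('k \<Rightarrow> real^3) \<Rightarrow>
     ('k \<Rightarrow> 2 \<Rightarrow> real^3) \<Rightarrow> (real \<Rightarrow> real) \<Rightarrow> ('m::finite \<Rightarrow> real^'k) \<Rightarrow>
     real^'k \<Rightarrow> real^'m \<Rightarrow> real" where
  "H_fun h p q b r g f \<alpha> =
     (\<Sum>s\<in>UNIV. \<alpha> $ s *
        (\<Sum>j\<in>UNIV. h (Sigma_field p q b r f j) (Sigma_field p q b r (g s) j)))"

end

theory Submission
  imports Defs
begin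

text \<open>Because \<open>h \<ge> 0\<close>, the convergence of \<open>\<alpha>\<close> gives, for every \<open>c < 1\<close>,
  \<open>c H(f; \<alpha> 0) \<le> H(f; \<alpha> l)\<close> uniformly in \<open>f\<close> once \<open>l\<close> is large. Hence the \<open>fhat l\<close> form a
  minimizing sequence of \<open>H(\<cdot>; \<alpha> 0)\<close>. The domain is relatively open in the compact simplex, so a
  small sphere around the unique minimizer meets the simplex in a compact subset of the domain, on
  which \<open>H(\<cdot>; \<alpha> 0)\<close> exceeds its minimum by some \<open>\<eta> > 0\<close>; by convexity it does so everywhere
  outside the sphere, even near boundary points that are missing from the domain.\<close>

lemma convex_on_unique_min_separated:
  fixes F :: "'a::euclidean_space \<Rightarrow> real"
  assumes cvx: "convex_on K F" and cont: "continuous_on K F"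
    and ope: "openin (top_of_set C) K" and C: "closed C"
    and x0: "x0 \<in> K" and uniq: "\<And>x. x \<in> K \<Longrightarrow> x \<noteq> x0 \<Longrightarrow> F x0 < F x"
    and e: "e > 0"
  obtains \<eta> where "\<eta> > 0" "\<And>x. x \<in> K \<Longrightarrow> e \<le> dist x0 x \<Longrightarrow> F x0 + \<eta> \<le> F x"
proof -
  from ope x0 obtain d0 where d0: "d0 > 0" "ball x0 d0 \<inter> C \<subseteq> K"
    by (auto simp: openin_contains_ball)
  \<comment> \<open>The bound \<open>d \<le> e\<close> puts the sphere between \<open>x0\<close> and
    the points to be estimated; the halving gives \<open>d < d0\<close>, so the closed sphere stays
    inside the open ball where \<open>C\<close> lies in \<open>K\<close>.\<close>
  define d where "d = min e (d0 / 2)"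
  have d: "d > 0" "d \<le> e" "d < d0" using d0 e by (auto simp: d_def)
  define S where "S = sphere x0 d \<inter> C"
  have "compact S" unfolding S_def using C by (intro compact_Int_closed compact_sphere)
  have SK: "S \<subseteq> K" using d0 d by (auto simp: S_def)
  \<comment> \<open>The minimum over the compact set \<open>S\<close> is attained at a point other
    than \<open>x0\<close>, because \<open>d > 0\<close>. If \<open>S\<close> is empty, the value 1
    works vacuously.\<close>
  have "\<exists>\<eta>>0. \<forall>x\<in>S. F x0 + \<eta> \<le> F x"
  proof (cases "S = {}")
    case False
    then obtain y where y: "y \<in> S" "\<And>x. x \<in> S \<Longrightarrow> F y \<le> F x"
      using continuous_attains_inf[OF \<open>compact S\<close>] continuous_on_subset[OF cont SK] by blast
    have "F x0 < F y" using uniq y SK d by (auto simp: S_def)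
    then show ?thesis using y by (intro exI[of _ "F y - F x0"]) auto
  qed (auto intro: exI[of _ 1])
  then obtain \<eta> where \<eta>: "\<eta> > 0" "\<And>x. x \<in> S \<Longrightarrow> F x0 + \<eta> \<le> F x" by blast
  have "F x0 + \<eta> \<le> F x" if x: "x \<in> K" "e \<le> dist x0 x" for x
  proof -
    \<comment> \<open>\<open>t\<close> is the parameter at which the segment from \<open>x0\<close>
      to \<open>x\<close> crosses the sphere of radius \<open>d\<close>; the crossing point is
      \<open>y\<close>.\<close>
    define t where "t = d / dist x0 x"
    have t: "0 < t" "t \<le> 1" using d x by (auto simp: t_def divide_simps)
    define y where "y = (1 - t) *\<^sub>R x0 + t *\<^sub>R x"
    have "y \<in> K" unfolding y_def
      using convex_on_imp_convex[OF cvx] x0 x t by (intro convexD) auto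
    then have "y \<in> C" using openin_subset[OF ope] by auto
    have "x0 - y = t *\<^sub>R (x0 - x)" by (simp add: y_def algebra_simps)
    then have "dist x0 y = t * dist x0 x" using t by (simp add: dist_norm)
    also have "\<dots> = d" using d x by (auto simp: t_def)
    finally have "y \<in> S" using \<open>y \<in> C\<close> by (simp add: S_def)
    then have "F x0 + \<eta> \<le> F y" by (rule \<eta>)
    also have "F y \<le> (1 - t) * F x0 + t * F x"
      unfolding y_def using x0 x t by (intro convex_onD[OF cvx]) auto
    \<comment> \<open>The excess at \<open>y\<close> is at most \<open>t\<close> times the excess at
      \<open>x\<close>. Since it is positive, so is the excess at \<open>x\<close>, and dropping the
      factor \<open>t \<le> 1\<close> can only enlarge the bound.\<close>
    finally have "\<eta> \<le> t * (F x - F x0)" by (simp add: algebra_simps)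
    with \<eta>(1) have "0 < t * (F x - F x0)" by linarith
    then have "t * (F x - F x0) \<le> F x - F x0"
      using t mult_right_mono[of t 1 "F x - F x0"] by (simp add: zero_less_mult_iff)
    with \<open>\<eta> \<le> t * (F x - F x0)\<close> show ?thesis by linarith
  qed
  with \<eta>(1) show ?thesis using that by blast
qed

text \<open>The functions \<open>G s\<close> may be unbounded on \<open>K\<close>, so convergence of
  the weights need not make the weighted sums converge uniformly. A one-sided multiplicative
  comparison, available because \<open>G s\<close> is nonnegative, takes the place of uniform
  convergence.\<close>

lemma weighted_argmin_converges:
  fixes G :: "'m::finite \<Rightarrow> 'a::euclidean_space \<Rightarrow> real" and w :: "nat \<Rightarrow> real^'m"
  assumes G: "\<And>s x. x \<in> K \<Longrightarrow> 0 \<le> G s x" "\<And>s. continuous_on K (G s)"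
    and w: "\<And>l s. 0 \<le> w l $ s" "\<And>s. 0 \<le> w0 $ s" "w \<longlonglongrightarrow> w0"
    and cvx: "convex_on K (\<lambda>x. \<Sum>s\<in>UNIV. w0 $ s * G s x)"
    and ope: "openin (top_of_set C) K" and C: "closed C"
    and x0: "x0 \<in> K"
    and uniq: "\<And>x. x \<in> K \<Longrightarrow> x \<noteq> x0 \<Longrightarrow>
        (\<Sum>s\<in>UNIV. w0 $ s * G s x0) < (\<Sum>s\<in>UNIV. w0 $ s * G s x)"
    and x: "\<And>l. x l \<in> K"
      "\<And>l. (\<Sum>s\<in>UNIV. w l $ s * G s (x l)) \<le> (\<Sum>s\<in>UNIV. w l $ s * G s x0)"
  shows "x \<longlonglongrightarrow> x0"
proof (rule tendstoI)
  fix e :: real assume "e > 0"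
  define F where "F v y = (\<Sum>s\<in>UNIV. v $ s * G s y)" for v :: "real^'m" and y
  have "continuous_on K (F w0)"
    unfolding F_def by (intro continuous_intros G)
  then obtain \<eta> where \<eta>: "\<eta> > 0" "\<And>y. y \<in> K \<Longrightarrow> e \<le> dist x0 y \<Longrightarrow> F w0 x0 + \<eta> \<le> F w0 y"
    using convex_on_unique_min_separated[of K "F w0" C x0 e] cvx ope C x0 uniq \<open>e > 0\<close>
    unfolding F_def by blast
  have F0: "0 \<le> F w0 x0" unfolding F_def using G(1) w(2) x0 by (intro sum_nonneg) auto
  \<comment> \<open>This \<open>c\<close> scales the level \<open>F w0 x0 + \<eta>\<close> down to
    \<open>F w0 x0 + \<eta> / 2\<close>, which is still strictly above the limit of
    \<open>F (w l) x0\<close>.\<close>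
  define c where "c = (F w0 x0 + \<eta> / 2) / (F w0 x0 + \<eta>)"
  have c: "0 < c" "c < 1" "c * (F w0 x0 + \<eta>) = F w0 x0 + \<eta> / 2"
    using F0 \<eta>(1) by (auto simp: c_def divide_simps)
  have ws: "(\<lambda>l. w l $ s) \<longlonglongrightarrow> w0 $ s" for s using w(3) by (rule tendsto_vec_nth)
  have "\<forall>\<^sub>F l in sequentially. c * w0 $ s \<le> w l $ s" for s
  \<comment> \<open>A positive limit weight strictly exceeds its multiple by \<open>c < 1\<close>,
    so convergence suffices. For a zero limit weight it would not, and the claim is just the
    nonnegativity of \<open>w l $ s\<close>.\<close>
  proof (cases "w0 $ s = 0")
    case False
    then have "c * w0 $ s < w0 $ s" using c w(2)[of s] by auto
    then have "\<forall>\<^sub>F l in sequentially. c * w0 $ s < w l $ s" using ws by (intro order_tendstoD)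
    then show ?thesis by eventually_elim simp
  qed (simp add: w)
  then have ev1: "\<forall>\<^sub>F l in sequentially. \<forall>s. c * w0 $ s \<le> w l $ s"
    by (rule eventually_all_finite)
  have "(\<lambda>l. F (w l) x0) \<longlonglongrightarrow> F w0 x0" unfolding F_def by (intro tendsto_intros ws)
  then have ev2: "\<forall>\<^sub>F l in sequentially. F (w l) x0 < F w0 x0 + \<eta> / 2"
    by (rule order_tendstoD) (use \<eta> in auto)
  from ev1 ev2 show "\<forall>\<^sub>F l in sequentially. dist (x l) x0 < e"
  proof eventually_elim
    case (elim l)
    \<comment> \<open>Comparing weights, then \<open>x l\<close> with \<open>x0\<close>, bounds
      \<open>F w0 (x l)\<close> strictly below the level that every point at distance at least
      \<open>e\<close> reaches.\<close>
    have "c * F w0 (x l) \<le> F (w l) (x l)"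
      unfolding F_def sum_distrib_left mult.assoc[symmetric]
      using elim G(1)[OF x(1)] by (intro sum_mono mult_right_mono) auto
    also have "\<dots> \<le> F (w l) x0" using x(2) by (simp add: F_def)
    also have "\<dots> < c * (F w0 x0 + \<eta>)" using elim c by simp
    finally have "F w0 (x l) < F w0 x0 + \<eta>" using c(1) by (simp only: mult_less_cancel_left_pos)
    then show ?case using \<eta>(2)[OF x(1), of l] by (metis dist_commute not_le)
  qed
qed

lemma inner_matrix_vector_mult_2:
  fixes A :: "real^2^2"
  assumes "transpose A = A"
  shows "x \<bullet> (A *v x) = A$1$1 * (x$1)\<^sup>2 + 2 * A$1$2 * x$1 * x$2 + A$2$2 * (x$2)\<^sup>2"
proof -
  have "A$2$1 = transpose A$1$2" by (simp add: transpose_def)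
  then have "A$2$1 = A$1$2" by (simp add: assms)
  then show ?thesis
    by (simp add: inner_vec_def matrix_vector_mult_def sum_2 power2_eq_square algebra_simps)
qed

text \<open>Sylvester's criterion in dimension two. It turns positive definiteness, a condition on
  all vectors, into two strict polynomial inequalities in the entries, from which openness can be
  read off.\<close>

lemma Sym_pos_iff:
  "A \<in> Sym_pos \<longleftrightarrow> transpose A = A \<and> 0 < A$1$1 \<and> (A$1$2)\<^sup>2 < A$1$1 * A$2$2"
proof (cases "transpose A = A")
  case True
  note q = inner_matrix_vector_mult_2[OF True]
  show ?thesis
  proof
    assume A: "A \<in> Sym_pos"
    have pos: "0 < x \<bullet> (A *v x)" if "x \<noteq> 0" for x using A that by (auto simp: Sym_pos_def)
    have a: "0 < A$1$1"
      using pos[of "vector [1, 0]"] by (simp add: q vec_eq_iff forall_2)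
    \<comment> \<open>The test vector is orthogonal to the first row of \<open>A\<close>, so the
      quadratic form there equals \<open>A$1$1\<close> times the determinant.\<close>
    have "0 < A$1$1 * (A$1$1 * A$2$2 - (A$1$2)\<^sup>2)"
      using pos[of "vector [- A$1$2, A$1$1]"] a
      by (simp add: q vec_eq_iff forall_2 power2_eq_square algebra_simps)
    with a True show "transpose A = A \<and> 0 < A$1$1 \<and> (A$1$2)\<^sup>2 < A$1$1 * A$2$2"
      by (simp add: zero_less_mult_iff)
  next
    assume A: "transpose A = A \<and> 0 < A$1$1 \<and> (A$1$2)\<^sup>2 < A$1$1 * A$2$2"
    have "0 < x \<bullet> (A *v x)" if "x \<noteq> 0" for x
    proof -
      \<comment> \<open>Completing the square, with the factor \<open>A$1$1\<close> kept on the left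
        to avoid division.\<close>
      have "A$1$1 * (x \<bullet> (A *v x)) =
          (A$1$1 * x$1 + A$1$2 * x$2)\<^sup>2 + (A$1$1 * A$2$2 - (A$1$2)\<^sup>2) * (x$2)\<^sup>2"
        by (simp add: q power2_eq_square algebra_simps)
      also have "\<dots> > 0"
      proof (cases "x$2 = 0")
        case True
        then have "x$1 \<noteq> 0" using that by (auto simp: vec_eq_iff forall_2)
        then show ?thesis using True A by simp
      next
        case False
        then show ?thesis using A by (intro add_nonneg_pos mult_pos_pos) auto
      qed
      finally show ?thesis using A by (simp add: zero_less_mult_iff)
    qed
    with True show "A \<in> Sym_pos" by (simp add: Sym_pos_def)
  qed
qed (simp add: Sym_pos_def)

lemma transpose_Sigma_field: "transpose (Sigma_field p q b r f j) = Sigma_field p q b r f j"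
  by (simp add: vec_eq_iff transpose_def Sigma_field_def outer_square_def columnvector_def
      matrix_matrix_mult_def mult.commute)

lemma continuous_on_Sigma_field [continuous_intros]:
  "continuous_on S (\<lambda>f. Sigma_field p q b r f j)"
  unfolding Sigma_field_def by (intro continuous_intros)

text \<open>Symmetry of the matrices is automatic, so within the simplex only finitely many strict
  inequalities between continuous functions of \<open>f\<close> remain.\<close>

lemma openin_regular_pmfs: "openin (top_of_set prob_simplex) (regular_pmfs p q b r)"
proof -
  have "open (\<Inter>j\<in>UNIV. {f. 0 < Sigma_field p q b r f j $ 1 $ 1 \<and>
      (Sigma_field p q b r f j $ 1 $ 2)\<^sup>2
        < Sigma_field p q b r f j $ 1 $ 1 * Sigma_field p q b r f j $ 2 $ 2})" (is "open ?U")
    by (intro open_INT ballI open_Collect_conj open_Collect_less continuous_intros) simp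
  moreover have "regular_pmfs p q b r = prob_simplex \<inter> ?U"
    by (auto simp: regular_pmfs_def Sym_pos_iff transpose_Sigma_field)
  ultimately show ?thesis by (auto simp: openin_open)
qed

lemma closed_prob_simplex: "closed (prob_simplex :: (real^'n) set)"
  unfolding prob_simplex_def
  by (intro closed_Collect_conj closed_Collect_all closed_Collect_le closed_Collect_eq
      continuous_intros)

theorem proposition1:
  fixes p q :: "'k::finite \<Rightarrow> real^3"
    and b :: "'k \<Rightarrow> 2 \<Rightarrow> real^3"
    and r :: "real \<Rightarrow> real"
    and g :: "'m::finite \<Rightarrow> real^'k"
    and h :: "real^2^2 \<Rightarrow> real^2^2 \<Rightarrow> real"
    and \<alpha> :: "nat \<Rightarrow> real^'m"
    and fhat :: "nat \<Rightarrow> real^'k"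
  assumes "\<And>i. p i \<in> sphere 0 1"
    and "\<And>j. q j \<in> sphere 0 1"
    and "\<And>i j. p i \<noteq> - q j"
    and "\<And>j. tangent_basis (q j) (b j)"
    and "r = (\<lambda>t. 1) \<or> (r = (\<lambda>t. (1 - pi / (2 * t))\<^sup>2) \<and> (\<forall>i j. p i \<noteq> q j))"
    and "\<And>s. g s \<in> regular_pmfs p q b r"
    and "similarity_invariant h"
    and "nonneg_on_Sym_pos h"
    and "\<And>l. \<alpha> l \<in> prob_simplex"
    and "\<alpha> \<longlonglongrightarrow> \<alpha> 0"
    and "convex_on (regular_pmfs p q b r) (\<lambda>f. H_fun h p q b r g f (\<alpha> 0))"
    and "\<And>l. is_arg_min (\<lambda>f. H_fun h p q b r g f (\<alpha> l)) (\<lambda>f. f \<in> regular_pmfs p q b r) (fhat l)"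
    and "\<And>f. is_arg_min (\<lambda>f. H_fun h p q b r g f (\<alpha> 0)) (\<lambda>f. f \<in> regular_pmfs p q b r) f
           \<Longrightarrow> f = fhat 0"
  shows "fhat \<longlonglongrightarrow> fhat 0"
proof -
  let ?K = "regular_pmfs p q b r"
  \<comment> \<open>\<open>G s f\<close> is the total discrepancy between the fields of
    \<open>f\<close> and \<open>g s\<close>; \<open>H_fun\<close> is its average over
    \<open>s\<close> with weights \<alpha>.\<close>
  define G where
    "G s f = (\<Sum>j\<in>UNIV. h (Sigma_field p q b r f j) (Sigma_field p q b r (g s) j))" for s f
  have H: "H_fun h p q b r g f a = (\<Sum>s\<in>UNIV. a $ s * G s f)" for f a
    by (simp add: H_fun_def G_def)
  have Sym: "Sigma_field p q b r f j \<in> Sym_pos" if "f \<in> ?K" for f j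
    using that by (simp add: regular_pmfs_def)
  have min: "fhat l \<in> ?K" "\<And>f. f \<in> ?K \<Longrightarrow> H_fun h p q b r g (fhat l) (\<alpha> l) \<le> H_fun h p q b r g f (\<alpha> l)"
    for l using assms(12)[of l] by (auto simp: is_arg_min_linorder)
  show ?thesis
  proof (rule weighted_argmin_converges[where K = ?K and C = prob_simplex and G = G and w = \<alpha>])
    show "0 \<le> G s f" if "f \<in> ?K" for s f
      unfolding G_def using assms(6,8) Sym that
      by (intro sum_nonneg) (auto simp: nonneg_on_Sym_pos_def)
    show "continuous_on ?K (G s)" for s
      unfolding G_def
    proof (intro continuous_on_sum)
      fix j
      have "continuous_on (Sym_pos \<times> Sym_pos) (\<lambda>(X, Y). h X Y)"
        using assms(7) by (simp add: similarity_invariant_def)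
      from continuous_on_compose2[OF this,
          of ?K "\<lambda>f. (Sigma_field p q b r f j, Sigma_field p q b r (g s) j)"]
      show "continuous_on ?K (\<lambda>f. h (Sigma_field p q b r f j) (Sigma_field p q b r (g s) j))"
        using Sym assms(6) by (force intro!: continuous_on_Pair continuous_on_Sigma_field continuous_on_const)
    qed
    show "0 \<le> \<alpha> l $ s" for l s
      using assms(9)[of l] by (simp add: prob_simplex_def)
    then show "0 \<le> \<alpha> 0 $ s" for s .
    show "\<alpha> \<longlonglongrightarrow> \<alpha> 0" by (fact assms(10))
    show "convex_on ?K (\<lambda>f. \<Sum>s\<in>UNIV. \<alpha> 0 $ s * G s f)"
      using assms(11) by (simp add: H)
    show "(\<Sum>s\<in>UNIV. \<alpha> 0 $ s * G s (fhat 0)) < (\<Sum>s\<in>UNIV. \<alpha> 0 $ s * G s f)"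
      if f: "f \<in> ?K" "f \<noteq> fhat 0" for f
    \<comment> \<open>A competitor with no larger value would itself be a minimizer, so uniqueness
      of the minimizer yields the strict inequality.\<close>
    proof (rule ccontr)
      assume "\<not> ?thesis"
      then have "H_fun h p q b r g f (\<alpha> 0) \<le> H_fun h p q b r g (fhat 0) (\<alpha> 0)"
        by (simp add: H)
      then have "is_arg_min (\<lambda>f. H_fun h p q b r g f (\<alpha> 0)) (\<lambda>f. f \<in> ?K) f"
        using f(1) min(2)[of _ 0] by (force simp: is_arg_min_linorder)
      with assms(13) f(2) show False by blast
    qed
    show "(\<Sum>s\<in>UNIV. \<alpha> l $ s * G s (fhat l)) \<le> (\<Sum>s\<in>UNIV. \<alpha> l $ s * G s (fhat 0))" for l
      using min(2)[OF min(1)[of 0], of l] by (simp add: H)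
  qed (simp_all add: min openin_regular_pmfs closed_prob_simplex)
qed

end
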